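(* Let $\mathcal H$ be a complex separable Hilbert space and let $T\in\mathcal B(\mathcal H)$ be a left invertible $m$-concave operator for some $m\geqslant2$. If $T$ satisfies $$\beta_r(T)\geqslant\sum_{k=1}^\infty{L_T^*}^k\beta_{r+1}(T)L_T^k,\qquad r=1,\ldots,m-2,$$ then $T$ admits a Wold-type decomposition.
   Context: For $T\in\mathcal B(\mathcal H)$ and $k\ge1$, $\beta_k(T):=\sum_{j=0}^k\binom kj(-1)^{k-j}{T^*}^jT^j$, and $\beta_0(T)=I$. $T$ is $m$-concave if $\beta_m(T)\leqslant0$. For a left invertible $T$, $L_T:=(T^*T)^{-1}T^*$. An inequality $B\geqslant\sum_{k=1}^\infty C_k$ between self-adjoint operators means that for every $x\in\mathcal H$ the series $\sum_k\langle C_kx,x\rangle$ converges and is at most $\langle Bx,x\rangle$. For $m=2$ the set of inequalities is vacuous. The hyper-range of $T$ is $\mathcal H_\infty(T):=\bigcap_{n=0}^\infty T^n(\mathcal H)$. An operator $S$ on a Hilbert space $\mathcal K$ has the wandering subspace property if the closed linear span of $\{S^nx:x\in\ker S^*,\ n\ge0\}$ is $\mathcal K$. $T$ admits a Wold-type decomposition if (i) $\mathcal H_\infty(T)$ is a reducing subspace for $T$ and $T|_{\mathcal H_\infty(T)}$ is a unitary operator, and (ii) $T|_{\mathcal H_\infty(T)^\perp}$ has the wandering subspace property. *)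

theory Defs
  imports "HOL-Analysis.Analysis" "HOL-Library.Complex_Order"
begin

text \<open>The class extends real Hilbert spaces (\<open>real_inner\<close> and \<open>complete_space\<close>), so norm and topology
  are the library's. The last axiom identifies the real inner product with the real part of
  \<open>cinner\<close>; it makes \<open>cinner\<close> positive definite and gives \<open>norm x = sqrt (Re (cinner x x))\<close>.
  \<open>cinner\<close> is linear in its first argument.\<close>

class complex_hilbert = real_inner + complete_space +
  fixes scaleC :: "complex \<Rightarrow> 'a \<Rightarrow> 'a"  (infixr "*\<^sub>C" 75)
    and cinner :: "'a \<Rightarrow> 'a \<Rightarrow> complex"
  assumes scaleC_add_right: "a *\<^sub>C (x + y) = a *\<^sub>C x + a *\<^sub>C y"
    and scaleC_add_left: "(a + b) *\<^sub>C x = a *\<^sub>C x + b *\<^sub>C x"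
    and scaleC_scaleC: "a *\<^sub>C b *\<^sub>C x = (a * b) *\<^sub>C x"
    and scaleC_of_real: "complex_of_real r *\<^sub>C x = r *\<^sub>R x"
    and cinner_commute: "cinner x y = cnj (cinner y x)"
    and cinner_add_left: "cinner (x + y) z = cinner x z + cinner y z"
    and cinner_scaleC_left: "cinner (a *\<^sub>C x) y = a * cinner x y"
    and inner_eq_Re_cinner: "inner x y = Re (cinner x y)"

global_interpretation complex_vector: vector_space "scaleC :: complex \<Rightarrow> 'a \<Rightarrow> 'a::complex_hilbert"
  defines csubspace = complex_vector.subspace
    and cspan = complex_vector.span
proof
  fix a b :: complex and x y :: 'a
  show "a *\<^sub>C (x + y) = a *\<^sub>C x + a *\<^sub>C y" by (rule scaleC_add_right)
  show "(a + b) *\<^sub>C x = a *\<^sub>C x + b *\<^sub>C x" by (rule scaleC_add_left)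
  show "a *\<^sub>C b *\<^sub>C x = (a * b) *\<^sub>C x" by (rule scaleC_scaleC)
  show "1 *\<^sub>C x = x" using scaleC_of_real [of 1 x] by simp
qed

definition cortho_comp :: "'a::complex_hilbert set \<Rightarrow> 'a set" where
  "cortho_comp M = {x. \<forall>y\<in>M. cinner x y = 0}"

definition bounded_clinear :: "('a::complex_hilbert \<Rightarrow> 'a) \<Rightarrow> bool" where
  "bounded_clinear T \<longleftrightarrow> bounded_linear T \<and> (\<forall>c x. T (c *\<^sub>C x) = c *\<^sub>C T x)"

text \<open>An operator on a closed subspace \<open>K\<close> is represented by a function on the whole type that leaves
  \<open>K\<close> invariant; only its values on \<open>K\<close> matter. \<open>cadjoint_on K S\<close> is the adjoint of \<open>S\<close> as an
  operator on the Hilbert space \<open>K\<close>. Its existence and uniqueness on \<open>K\<close> come from the Riesz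
  representation theorem; the values outside \<open>K\<close> have no meaning.\<close>

definition cadjoint_on :: "'a::complex_hilbert set \<Rightarrow> ('a \<Rightarrow> 'a) \<Rightarrow> 'a \<Rightarrow> 'a" where
  "cadjoint_on K S y = (THE z. z \<in> K \<and> (\<forall>x\<in>K. cinner (S x) y = cinner x z))"

abbreviation cadjoint :: "('a::complex_hilbert \<Rightarrow> 'a) \<Rightarrow> 'a \<Rightarrow> 'a" where
  "cadjoint \<equiv> cadjoint_on UNIV"

definition left_invertible :: "('a::complex_hilbert \<Rightarrow> 'a) \<Rightarrow> bool" where
  "left_invertible T \<longleftrightarrow> (\<exists>S. bounded_clinear S \<and> S \<circ> T = id)"

text \<open>\<open>T\<^sup>*T\<close> is bijective when \<open>T\<close> is left invertible, so \<open>inv\<close> is then its inverse.\<close>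

definition left_inv_op :: "('a::complex_hilbert \<Rightarrow> 'a) \<Rightarrow> 'a \<Rightarrow> 'a" where
  "left_inv_op T = inv (cadjoint T \<circ> T) \<circ> cadjoint T"

definition beta_op :: "nat \<Rightarrow> ('a::complex_hilbert \<Rightarrow> 'a) \<Rightarrow> 'a \<Rightarrow> 'a" where
  "beta_op k T x =
     (\<Sum>j\<le>k. (of_nat (k choose j) * (- 1) ^ (k - j)) *\<^sub>C (cadjoint T ^^ j) ((T ^^ j) x))"

text \<open>The order on \<open>complex\<close> is the one of \<open>Complex_Order\<close>, where \<open>z \<le> w\<close> means that \<open>w - z\<close> is a
  nonnegative real.\<close>

definition op_le :: "('a::complex_hilbert \<Rightarrow> 'a) \<Rightarrow> ('a \<Rightarrow> 'a) \<Rightarrow> bool" where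
  "op_le A B \<longleftrightarrow> (\<forall>x. cinner (A x) x \<le> cinner (B x) x)"

definition op_series_le :: "(nat \<Rightarrow> 'a::complex_hilbert \<Rightarrow> 'a) \<Rightarrow> ('a \<Rightarrow> 'a) \<Rightarrow> bool" where
  "op_series_le C B \<longleftrightarrow>
     (\<forall>x. summable (\<lambda>k. cinner (C (Suc k) x) x) \<and>
          (\<Sum>k. cinner (C (Suc k) x) x) \<le> cinner (B x) x)"

definition m_concave :: "nat \<Rightarrow> ('a::complex_hilbert \<Rightarrow> 'a) \<Rightarrow> bool" where
  "m_concave m T \<longleftrightarrow> op_le (beta_op m T) (\<lambda>x. 0)"

definition hyper_range :: "('a::complex_hilbert \<Rightarrow> 'a) \<Rightarrow> 'a set" where
  "hyper_range T = (\<Inter>n. range (T ^^ n))"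

definition reducing :: "('a::complex_hilbert \<Rightarrow> 'a) \<Rightarrow> 'a set \<Rightarrow> bool" where
  "reducing T M \<longleftrightarrow>
     csubspace M \<and> closed M \<and> T ` M \<subseteq> M \<and> T ` cortho_comp M \<subseteq> cortho_comp M"

definition unitary_on :: "'a::complex_hilbert set \<Rightarrow> ('a \<Rightarrow> 'a) \<Rightarrow> bool" where
  "unitary_on K S \<longleftrightarrow>
     S ` K \<subseteq> K \<and> (\<forall>x\<in>K. cadjoint_on K S (S x) = x \<and> S (cadjoint_on K S x) = x)"

definition wandering_subspace_property_on :: "'a::complex_hilbert set \<Rightarrow> ('a \<Rightarrow> 'a) \<Rightarrow> bool" where
  "wandering_subspace_property_on K S \<longleftrightarrow>
     closure (cspan {(S ^^ n) x | n x. x \<in> K \<and> cadjoint_on K S x = 0}) = K"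

definition admits_Wold_type_decomposition :: "('a::complex_hilbert \<Rightarrow> 'a) \<Rightarrow> bool" where
  "admits_Wold_type_decomposition T \<longleftrightarrow>
     reducing T (hyper_range T) \<and> unitary_on (hyper_range T) T \<and>
     wandering_subspace_property_on (cortho_comp (hyper_range T)) T"

end

theory Submission
  imports Defs
begin

text \<open>Write \<open>b r x\<close> for \<open>\<langle>\<beta>\<^sub>r(T) x, x\<rangle>\<close> and \<open>L\<close> for \<open>L\<^sub>T\<close>. Since
  \<open>b (r + 1) x = b r (T x) - b r x\<close>, these are the iterated differences of
  \<open>n \<mapsto> \<parallel>T\<^sup>n x\<parallel>\<^sup>2\<close>, and concavity of order \<open>m\<close> says that the \<open>m\<close>-th differences are
  nonpositive. The norms would turn negative if the differences of order \<open>m - 1\<close> were not nonnegative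
  (\<open>top_beta_nonneg\<close>), and by the domination conditions all \<open>b r\<close> with \<open>1 \<le> r < m\<close> are then
  nonnegative (\<open>beta_nonneg\<close>).

  The operator \<open>T L\<close> is the projection onto the range of \<open>T\<close>, which gives
  \<open>\<Sum>\<^sub>k\<^sub>\<ge>\<^sub>1 b 1 (L\<^sup>k x) \<le> \<parallel>x\<parallel>\<^sup>2\<close> (\<open>energy_le\<close>), the analogue for \<open>r = 0\<close> of the domination
  conditions. Chaining all of them yields
  \<open>\<Sum>\<^sub>n (n choose r - 1) * b r (L\<^sup>n\<^sup>+\<^sup>1 x) \<le> \<parallel>x\<parallel>\<^sup>2\<close> (\<open>weighted_beta_sum_le\<close>). On the other hand,
  concavity bounds \<open>\<parallel>T\<^sup>n y\<parallel>\<^sup>2\<close> by the Newton expansion \<open>\<Sum>\<^sub>i\<^sub><\<^sub>m (n choose i) * b i y\<close>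
  (\<open>norm_funpow_T_le\<close>). For \<open>y = L\<^sup>n x\<close> the terms with \<open>i \<ge> 1\<close> are at most \<open>n\<close> times the terms of
  a convergent series; as the harmonic series diverges, they are arbitrarily small for infinitely
  many \<open>n\<close>. For such \<open>n\<close>, \<open>\<parallel>T\<^sup>n L\<^sup>n x\<parallel>\<^sup>2\<close> hardly exceeds \<open>\<parallel>L\<^sup>n x\<parallel>\<^sup>2 \<le> \<parallel>x\<parallel>\<^sup>2\<close>
  (\<open>norm_T_L_less_frequently\<close>).

  Both halves of the decomposition follow from this estimate. If \<open>x\<close> lies in the hyper-range, then
  \<open>T\<^sup>n L\<^sup>n x = x\<close> and \<open>\<parallel>x\<parallel>\<^sup>2 - \<parallel>L\<^sup>n x\<parallel>\<^sup>2\<close> is the sum of the \<open>b 1 (L\<^sup>k x)\<close> with \<open>1 \<le> k \<le> n\<close>, so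
  these vanish and \<open>T\<^sup>*T\<close> is the identity on the hyper-range (\<open>beta_one_hyper_range\<close>,
  \<open>cadjoint_T_T_hyper_range\<close>). If \<open>x\<close> is orthogonal to all \<open>T\<^sup>n e\<close> with \<open>e\<close> in the kernel of
  \<open>T\<^sup>*\<close>, then \<open>x\<close> is orthogonal to \<open>x - T\<^sup>n L\<^sup>n x\<close>, and the estimate makes a subsequence of
  \<open>T\<^sup>n L\<^sup>n x\<close> converge to \<open>x\<close>; hence \<open>x\<close> lies in the hyper-range
  (\<open>orthogonal_to_wandering_imp_in_hyper_range\<close>). So no nonzero vector of the orthogonal complement
  of the hyper-range is orthogonal to the wandering vectors.\<close>

section \<open>Complex inner products\<close>

lemma bounded_clinearD:
  assumes "bounded_clinear T"
  shows "bounded_linear T" and "T (c *\<^sub>C x) = c *\<^sub>C T x"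
  using assms by (auto simp: bounded_clinear_def)

lemma cinner_scaleC_right: "cinner x (a *\<^sub>C y) = cnj a * cinner x y"
  by (metis cinner_commute cinner_scaleC_left complex_cnj_mult)

lemma cinner_zero_left [simp]: "cinner 0 x = 0"
  using cinner_add_left [of 0 0 x] by simp

lemma cinner_zero_right [simp]: "cinner x 0 = 0"
  by (metis cinner_commute cinner_zero_left complex_cnj_zero)

lemma cinner_minus_left: "cinner (- x) y = - cinner x y"
  using cinner_add_left [of x "- x" y] by (simp add: eq_neg_iff_add_eq_0 add.commute)

lemma cinner_diff_left: "cinner (x - y) z = cinner x z - cinner y z"
  using cinner_add_left [of x "- y" z] by (simp add: cinner_minus_left)

lemma cinner_diff_right: "cinner x (y - z) = cinner x y - cinner x z"
  by (metis cinner_commute cinner_diff_left complex_cnj_diff)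

lemma cinner_sum_left: "cinner (\<Sum>i\<in>A. f i) y = (\<Sum>i\<in>A. cinner (f i) y)"
  by (induction A rule: infinite_finite_induct) (auto simp: cinner_add_left)

lemma cinner_self: "cinner x x = complex_of_real ((norm x)\<^sup>2)"
proof (rule complex_eqI)
  show "Re (cinner x x) = Re (complex_of_real ((norm x)\<^sup>2))"
    by (simp add: inner_eq_Re_cinner [symmetric] power2_norm_eq_inner)
  have "Im (cinner x x) = - Im (cinner x x)"
    using arg_cong [OF cinner_commute [of x x], of Im] by simp
  then show "Im (cinner x x) = Im (complex_of_real ((norm x)\<^sup>2))"
    by simp
qed

text \<open>Multiplication by \<open>-\<i>\<close> turns imaginary parts into real parts, so an identity between
  real inner products that holds for all vectors of a complex subspace lifts to \<open>cinner\<close>.\<close>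

lemma Im_cinner: "Im (cinner x y) = inner ((- \<i>) *\<^sub>C x) y"
  unfolding inner_eq_Re_cinner cinner_scaleC_left by simp

lemma cinner_eqI:
  assumes "\<And>x. cinner x y = cinner x z"
  shows "y = z"
proof -
  have "cinner (y - z) (y - z) = 0"
    using assms [of "y - z"] by (simp add: cinner_diff_right)
  then show ?thesis
    by (simp add: cinner_self)
qed

lemma cortho_compD: "x \<in> cortho_comp M \<Longrightarrow> y \<in> M \<Longrightarrow> cinner x y = 0"
  by (simp add: cortho_comp_def)

lemma csubspace_cortho_comp: "csubspace (cortho_comp M)"
  by (auto simp: complex_vector.subspace_def cortho_comp_def cinner_add_left cinner_scaleC_left)

lemma continuous_on_cinner_left: "continuous_on UNIV (\<lambda>x. cinner x y)"
proof -
  have "continuous_on UNIV (\<lambda>x. complex_of_real (inner x y)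
          + \<i> * complex_of_real (inner x (\<i> *\<^sub>C y)))"
    by (intro continuous_intros)
  moreover have "complex_of_real (inner x y) + \<i> * complex_of_real (inner x (\<i> *\<^sub>C y)) = cinner x y" for x
    by (rule complex_eqI) (auto simp: inner_eq_Re_cinner cinner_scaleC_right)
  ultimately show ?thesis by simp
qed

lemma closed_cortho_comp: "closed (cortho_comp M)"
proof -
  have "cortho_comp M = (\<Inter>y\<in>M. (\<lambda>x. cinner x y) -` {0})"
    by (auto simp: cortho_comp_def)
  moreover have "closed ((\<lambda>x. cinner x y) -` {0})" for y :: 'a
    by (intro closed_vimage continuous_on_cinner_left) auto
  ultimately show ?thesis by auto
qed

lemma csubspace_imp_subspace: "csubspace M \<Longrightarrow> subspace M"
  unfolding complex_vector.subspace_def subspace_def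
  by (metis scaleC_of_real)

section \<open>Orthogonal projection, Riesz representation and adjoints\<close>

text \<open>A sequence in \<open>S\<close> whose distances to \<open>x\<close> tend to the infimum is Cauchy: by the parallelogram
  law, two almost closest points that are far apart would have a midpoint that is strictly closer.\<close>

lemma closest_point_exists_Hilbert:
  fixes S :: "'a::{real_inner, complete_space} set"
  assumes "convex S" "closed S" "S \<noteq> {}"
  shows "\<exists>y\<in>S. \<forall>z\<in>S. norm (x - y) \<le> norm (x - z)"
proof -
  define d where "d = (INF z\<in>S. (norm (x - z))\<^sup>2)"
  have bdd: "bdd_below ((\<lambda>z. (norm (x - z))\<^sup>2) ` S)"
    by (rule bdd_belowI2 [of _ 0]) simp
  have d_le: "d \<le> (norm (x - z))\<^sup>2" if "z \<in> S" for z
    unfolding d_def using bdd that by (rule cINF_lower)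
  have "\<exists>y\<in>S. (norm (x - y))\<^sup>2 < d + 1 / real (Suc n)" for n
    using cINF_less_iff [OF assms(3) bdd, of "d + 1 / real (Suc n)"] by (simp add: d_def)
  then obtain y where yS: "\<And>n. y n \<in> S" and y: "\<And>n. (norm (x - y n))\<^sup>2 < d + 1 / real (Suc n)"
    by metis
  have near: "(norm (y p - y q))\<^sup>2 < 4 / real (Suc N)" if "N \<le> p" "N \<le> q" for N p q
  proof -
    have "(1/2) *\<^sub>R y p + (1/2) *\<^sub>R y q \<in> S"
      using assms(1) yS by (intro convexD) auto
    then have mid: "d \<le> (norm (x - ((1/2) *\<^sub>R y p + (1/2) *\<^sub>R y q)))\<^sup>2"
      by (rule d_le)
    have "(norm (y p - y q))\<^sup>2 = 2 * (norm (x - y p))\<^sup>2 + 2 * (norm (x - y q))\<^sup>2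
        - 4 * (norm (x - ((1/2) *\<^sub>R y p + (1/2) *\<^sub>R y q)))\<^sup>2"
      by (simp add: power2_norm_eq_inner inner_simps inner_commute algebra_simps)
    moreover have "1 / real (Suc p) \<le> 1 / real (Suc N)" "1 / real (Suc q) \<le> 1 / real (Suc N)"
      using that by (auto intro!: divide_left_mono)
    ultimately show ?thesis
      using mid y [of p] y [of q] by simp
  qed
  have "Cauchy y"
  proof (rule CauchyI)
    fix e :: real assume "0 < e"
    obtain N where N: "4 / e\<^sup>2 < real (Suc N)"
      by (meson lessI less_trans of_nat_less_iff reals_Archimedean2)
    then have "4 / real (Suc N) < e\<^sup>2"
      using \<open>0 < e\<close> by (simp add: field_simps del: of_nat_Suc)
    then have "norm (y p - y q) < e" if "N \<le> p" "N \<le> q" for p q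
      using near [OF that] \<open>0 < e\<close> by (meson less_imp_le less_trans power_less_imp_less_base)
    then show "\<exists>N. \<forall>p\<ge>N. \<forall>q\<ge>N. norm (y p - y q) < e" by blast
  qed
  then obtain l where l: "y \<longlonglongrightarrow> l"
    by (meson Cauchy_convergent convergentD)
  have "l \<in> S"
    using assms(2) yS l by (meson closed_sequentially)
  have "(\<lambda>n. (norm (x - y n))\<^sup>2) \<longlonglongrightarrow> (norm (x - l))\<^sup>2"
    by (intro tendsto_intros l)
  moreover have "(\<lambda>n. d + 1 / real (Suc n)) \<longlonglongrightarrow> d"
    using tendsto_add [OF tendsto_const LIMSEQ_Suc [OF lim_1_over_n]] by simp
  ultimately have "(norm (x - l))\<^sup>2 \<le> d"
    by (rule LIMSEQ_le) (use y less_imp_le in blast)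
  then have "norm (x - l) \<le> norm (x - z)" if "z \<in> S" for z
    by (rule power2_le_imp_le [OF order_trans [OF _ d_le [OF that]]]) simp
  with \<open>l \<in> S\<close> show ?thesis by blast
qed

text \<open>For small \<open>t\<close> of the sign opposite to \<open>a\<close> the linear term dominates; \<open>t = - a / (\<bar>c\<bar> + 1)\<close>
  is small enough.\<close>

lemma quadratic_nonneg_imp_linear_part_zero:
  fixes a c :: real
  assumes "\<And>t. 0 \<le> 2 * t * a + t\<^sup>2 * c"
  shows "a = 0"
proof -
  have c: "\<bar>c\<bar> + 1 > 0" by simp
  define t where "t = - a / (\<bar>c\<bar> + 1)"
  have t: "t * (\<bar>c\<bar> + 1) = - a"
    using c by (simp add: t_def)
  have "0 \<le> 2 * t * a + t\<^sup>2 * c" by (rule assms)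
  also have "\<dots> \<le> 2 * t * a + t\<^sup>2 * (\<bar>c\<bar> + 1)"
    by (intro add_left_mono mult_left_mono) auto
  also have "t\<^sup>2 * (\<bar>c\<bar> + 1) = - (t * a)"
    using t by (simp add: power2_eq_square mult.assoc)
  also have "2 * t * a + - (t * a) = - (t\<^sup>2 * (\<bar>c\<bar> + 1))"
    using t by (simp add: power2_eq_square mult.assoc)
  finally have "t\<^sup>2 * (\<bar>c\<bar> + 1) \<le> 0" by simp
  then have "t = 0"
    using c by (auto simp: mult_le_0_iff)
  with t show ?thesis by simp
qed

text \<open>Minimality of the distance at \<open>y\<close> makes the first-order term along every direction \<open>s \<in> S\<close>
  vanish. Admitting a subspace that is not closed spares a proof that the closure of the span of the
  wandering vectors is a subspace.\<close>

lemma orthogonal_projection_exists: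
  fixes S :: "'a::{real_inner, complete_space} set"
  assumes "subspace S"
  obtains y where "y \<in> closure S" "\<And>s. s \<in> S \<Longrightarrow> inner (x - y) s = 0"
proof -
  have "convex (closure S)"
    using assms by (intro convex_closure subspace_imp_convex)
  moreover have "closure S \<noteq> {}"
    using subspace_0 [OF assms] by auto
  ultimately obtain y where y: "y \<in> closure S"
    and min: "\<And>z. z \<in> closure S \<Longrightarrow> norm (x - y) \<le> norm (x - z)"
    using closest_point_exists_Hilbert [of "closure S" x] by auto
  have "inner (x - y) s = 0" if "s \<in> S" for s
  proof (rule quadratic_nonneg_imp_linear_part_zero)
    fix t :: real
    obtain f where f: "\<And>n. f n \<in> S" "f \<longlonglongrightarrow> y"
      using y by (auto simp: closure_sequential)
    have "(\<lambda>n. f n - t *\<^sub>R s) \<longlonglongrightarrow> y - t *\<^sub>R s"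
      by (intro tendsto_intros f)
    moreover have "f n - t *\<^sub>R s \<in> S" for n
      using f(1) \<open>s \<in> S\<close> assms by (simp add: subspace_diff subspace_scale)
    ultimately have "y - t *\<^sub>R s \<in> closure S"
      unfolding closure_sequential by (intro exI [of _ "\<lambda>n. f n - t *\<^sub>R s"]) simp
    from min [OF this] have "inner (x - y) (x - y) \<le> inner (x - (y - t *\<^sub>R s)) (x - (y - t *\<^sub>R s))"
      by (simp only: norm_le)
    then show "0 \<le> 2 * t * inner (x - y) s + t\<^sup>2 * inner s s"
      by (simp add: inner_diff_left inner_diff_right inner_commute power2_eq_square algebra_simps)
  qed
  with y that show thesis by blast
qed

text \<open>The representing vector is a multiple of a nonzero vector orthogonal to the kernel of \<open>f\<close>.\<close>

lemma Riesz_representation: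
  fixes f :: "'a::{real_inner, complete_space} \<Rightarrow> real"
  assumes "bounded_linear f"
  obtains z where "\<And>x. f x = inner x z"
proof (cases "\<forall>x. f x = 0")
  case True
  then show thesis using that [of 0] by simp
next
  case False
  then obtain x0 where x0: "f x0 \<noteq> 0" by blast
  interpret f: bounded_linear f by fact
  define S where "S = f -` {0}"
  have "subspace S"
    by (auto simp: S_def subspace_def f.zero f.add f.scaleR)
  have "closed S"
    unfolding S_def using f.continuous_on [OF continuous_on_id]
    by (intro closed_vimage) auto
  obtain y where y: "y \<in> closure S" "\<And>s. s \<in> S \<Longrightarrow> inner (x0 - y) s = 0"
    using orthogonal_projection_exists [OF \<open>subspace S\<close>] by blast
  define u where "u = x0 - y"
  have "f u = f x0"
    using y(1) closure_closed [OF \<open>closed S\<close>] by (simp add: u_def f.diff S_def)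
  with x0 have fu: "f u \<noteq> 0" by simp
  then have "u \<noteq> 0" using f.zero by auto
  have "f x = inner x ((f u / inner u u) *\<^sub>R u)" for x
  proof -
    have "x - (f x / f u) *\<^sub>R u \<in> S"
      using fu by (simp add: S_def f.diff f.scaleR)
    then have "inner u (x - (f x / f u) *\<^sub>R u) = 0"
      using y(2) by (simp add: u_def)
    then have "inner x u = f x / f u * inner u u"
      by (simp add: inner_diff_right inner_commute)
    with fu \<open>u \<noteq> 0\<close> show ?thesis by simp
  qed
  with that show thesis by blast
qed

text \<open>\<open>K\<close> has to be a subspace: two candidates for the adjoint differ by a vector of \<open>K\<close> that is
  orthogonal to \<open>K\<close>.\<close>

lemma cadjoint_on_eqI:
  assumes "csubspace K" "z \<in> K" "\<And>x. x \<in> K \<Longrightarrow> cinner (S x) y = cinner x z"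
  shows "cadjoint_on K S y = z"
  unfolding cadjoint_on_def
proof (rule the_equality)
  fix w assume w: "w \<in> K \<and> (\<forall>x\<in>K. cinner (S x) y = cinner x w)"
  have "w - z \<in> K"
    using assms(1,2) w by (simp add: complex_vector.subspace_diff)
  then have "cinner (w - z) (w - z) = 0"
    using w assms(3) by (simp add: cinner_diff_right)
  then show "w = z" by (simp add: cinner_self)
qed (use assms in auto)

text \<open>Riesz representation for the real functional \<open>\<lambda>x. Re (cinner (T x) y)\<close> gives the real
  part of the identity for all \<open>x\<close>. Its imaginary part is the real part at \<open>-\<i> x\<close>.\<close>

lemma cinner_cadjoint:
  assumes "bounded_clinear T"
  shows "cinner (T x) y = cinner x (cadjoint T y)"
proof -
  have "bounded_linear (\<lambda>x. inner (T x) y)"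
    using bounded_linear_compose [OF bounded_linear_inner_left bounded_clinearD(1) [OF assms]] .
  then obtain z where z: "\<And>x. inner (T x) y = inner x z"
    using Riesz_representation by blast
  have "cinner (T x) y = cinner x z" for x
  proof (rule complex_eqI)
    show "Re (cinner (T x) y) = Re (cinner x z)"
      using z [of x] by (simp add: inner_eq_Re_cinner)
    show "Im (cinner (T x) y) = Im (cinner x z)"
      using z [of "(- \<i>) *\<^sub>C x"] by (simp only: Im_cinner bounded_clinearD(2) [OF assms])
  qed
  then show ?thesis
    using cadjoint_on_eqI [of UNIV z T y] by simp
qed

lemma cinner_cadjoint_left: "bounded_clinear T \<Longrightarrow> cinner (cadjoint T x) y = cinner x (T y)"
  by (metis cinner_cadjoint cinner_commute)

lemma cinner_cadjoint_funpow:
  assumes "bounded_clinear T"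
  shows "cinner ((cadjoint T ^^ n) x) y = cinner x ((T ^^ n) y)"
  by (induction n arbitrary: y) (simp_all add: cinner_cadjoint_left [OF assms] funpow_swap1 [of T])

section \<open>The left inverse and the hyper-range\<close>

text \<open>For \<open>L = (T\<^sup>*T)\<^sup>-\<^sup>1T\<^sup>*\<close>, the operator \<open>T L\<close> is the orthogonal projection onto the
  range of \<open>T\<close>. This description, rather than the formula, is what all later arguments use.\<close>

locale left_invertible_operator =
  fixes T :: "'a::complex_hilbert \<Rightarrow> 'a"
  assumes T: "bounded_clinear T" and left_inv: "left_invertible T"
begin

abbreviation L :: "'a \<Rightarrow> 'a" where
  "L \<equiv> left_inv_op T"

sublocale T: bounded_linear T
  using T by (rule bounded_clinearD)

text \<open>Surjectivity: for a bounded left inverse \<open>S\<close>, \<open>y = T\<^sup>*S\<^sup>*y\<close>. The component of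
  \<open>S\<^sup>*y\<close> orthogonal to the range of \<open>T\<close> is killed by \<open>T\<^sup>*\<close>, and the other component lies in
  that range, because \<open>range T = {v. T (S v) = v}\<close> is closed.\<close>

lemma bij_cadjoint_T: "bij (cadjoint T \<circ> T)"
proof (rule bijI)
  obtain S where S: "bounded_clinear S" and ST: "\<And>x. S (T x) = x"
    using left_inv by (auto simp: left_invertible_def fun_eq_iff)
  have inj_T: "x = y" if "T x = T y" for x y
    using ST that by metis
  show "inj (cadjoint T \<circ> T)"
  proof (rule injI)
    fix x y assume "(cadjoint T \<circ> T) x = (cadjoint T \<circ> T) y"
    then have "cinner (T u) (T x) = cinner (T u) (T y)" for u
      by (simp add: cinner_cadjoint [OF T])
    then have "cinner (T (x - y)) (T x - T y) = 0"
      by (simp add: cinner_diff_right)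
    then have "T x - T y = 0"
      by (simp add: T.diff cinner_self)
    then show "x = y" by (simp add: inj_T)
  qed
  show "surj (cadjoint T \<circ> T)"
    unfolding surj_def
  proof
    fix y
    have T_S: "cadjoint T (cadjoint S y) = y"
      by (rule cinner_eqI) (simp add: ST cinner_cadjoint [OF T, symmetric] cinner_cadjoint [OF S, symmetric])
    have "subspace (range T)"
      by (rule linear_subspace_image [OF T.linear subspace_UNIV])
    then obtain w where w: "w \<in> closure (range T)"
      and orth: "\<And>s. s \<in> range T \<Longrightarrow> inner (cadjoint S y - w) s = 0"
      by (rule orthogonal_projection_exists) blast
    have "T (S w) = w"
    proof -
      have cl: "closed {v. T (S v) = v}"
        using bounded_clinearD(1) [OF S]
        by (intro closed_Collect_eq continuous_intros linear_continuous_on T.continuous_on)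
          (auto intro: linear_continuous_on)
      have "range T \<subseteq> {v. T (S v) = v}"
        using ST by auto
      then have "closure (range T) \<subseteq> {v. T (S v) = v}"
        using cl by (rule closure_minimal)
      with w show ?thesis by auto
    qed
    have "cinner u (cadjoint T w) = cinner u y" for u
    proof -
      have "cinner (cadjoint S y - w) (T u) = 0"
      proof (rule complex_eqI)
        show "Re (cinner (cadjoint S y - w) (T u)) = Re 0"
          using orth [of "T u"] by (simp add: inner_eq_Re_cinner)
        show "Im (cinner (cadjoint S y - w) (T u)) = Im 0"
          using orth [OF rangeI, of "\<i> *\<^sub>C u"]
          by (simp add: inner_eq_Re_cinner bounded_clinearD(2) [OF T] cinner_scaleC_right)
      qed
      then have "cinner (T u) (cadjoint S y - w) = 0"
        by (metis cinner_commute complex_cnj_zero)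
      then show ?thesis
        by (simp add: cinner_diff_right cinner_cadjoint [OF T] T_S)
    qed
    then have "cadjoint T w = y" by (rule cinner_eqI)
    then show "\<exists>v. y = (cadjoint T \<circ> T) v"
      using \<open>T (S w) = w\<close> by (intro exI [of _ "S w"]) simp
  qed
qed

lemma cadjoint_T_L: "cadjoint T (T (L x)) = cadjoint T x"
  using surj_f_inv_f [OF bij_is_surj [OF bij_cadjoint_T]] by (simp add: left_inv_op_def)

lemma L_T [simp]: "L (T x) = x"
  using inv_f_f [OF bij_is_inj [OF bij_cadjoint_T], of x] by (simp add: left_inv_op_def)

text \<open>The residual \<open>x - T (L x)\<close> is the part of \<open>x\<close> orthogonal to the range of \<open>T\<close>, that is,
  its component in the kernel of \<open>T\<^sup>*\<close>.\<close>

lemma cinner_residual_range: "cinner (x - T (L x)) (T u) = 0"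
proof -
  have "cinner (T (L x)) (T u) = cinner x (T u)"
    by (simp only: cinner_cadjoint_left [OF T, symmetric] cadjoint_T_L)
  then show ?thesis by (simp add: cinner_diff_left)
qed

text \<open>Being the orthogonal projection determines \<open>T L x\<close>, hence \<open>L x\<close>.
  Linearity of \<open>L\<close> is read off from this.\<close>

lemma residual_eqI:
  assumes "\<And>u. cinner (x - T v) (T u) = 0"
  shows "L x = v"
proof -
  have "T (L x - v) = (x - T v) - (x - T (L x))"
    by (simp add: T.diff)
  then have "cinner (T (L x - v)) (T (L x - v)) = 0"
    using cinner_residual_range [of x "L x - v"] assms [of "L x - v"]
    by (simp add: cinner_diff_left)
  then have "T (L x) = T v" by (simp add: cinner_self T.diff)
  then show ?thesis using L_T by metis
qed

lemma Pythagoras_residual: "(norm x)\<^sup>2 = (norm (x - T (L x)))\<^sup>2 + (norm (T (L x)))\<^sup>2"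
proof -
  have "inner (x - T (L x)) (T (L x)) = 0"
    by (simp add: inner_eq_Re_cinner cinner_residual_range)
  then show ?thesis
    using norm_add_Pythagorean [of "x - T (L x)" "T (L x)"] by (simp add: orthogonal_def)
qed

lemma bounded_clinear_L: "bounded_clinear L"
proof -
  obtain S where S: "bounded_clinear S" and ST: "\<And>x. S (T x) = x"
    using left_inv by (auto simp: left_invertible_def fun_eq_iff)
  have add: "L (x + y) = L x + L y" for x y
    using cinner_residual_range [of x] cinner_residual_range [of y]
    by (intro residual_eqI) (simp add: T.add cinner_add_left cinner_diff_left)
  have scaleC: "L (c *\<^sub>C x) = c *\<^sub>C L x" for c x
    using cinner_residual_range [of x]
    by (intro residual_eqI) (simp add: bounded_clinearD(2) [OF T] cinner_scaleC_left cinner_diff_left)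
  have "bounded_linear L"
  proof (rule bounded_linear_intro)
    show "L (r *\<^sub>R x) = r *\<^sub>R L x" for r x
      using scaleC by (simp flip: scaleC_of_real)
    show "norm (L x) \<le> norm x * onorm S" for x
    proof -
      have "norm (L x) \<le> onorm S * norm (T (L x))"
        using onorm [OF bounded_clinearD(1) [OF S], of "T (L x)"] by (simp add: ST)
      also have "\<dots> \<le> onorm S * norm x"
      proof (rule mult_left_mono)
        show "norm (T (L x)) \<le> norm x"
          using Pythagoras_residual [of x] by (simp add: power2_le_imp_le)
      qed (rule onorm_pos_le [OF bounded_clinearD(1) [OF S]])
      finally show ?thesis by (simp add: mult.commute)
    qed
  qed (rule add)
  with scaleC show ?thesis by (simp add: bounded_clinear_def)
qed

sublocale L: bounded_linear L
  using bounded_clinear_L by (rule bounded_clinearD)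

lemma funpow_L_T [simp]: "(L ^^ n) ((T ^^ n) x) = x"
  by (induction n arbitrary: x) (simp_all add: funpow_swap1 [of L])

lemma continuous_funpow_T_L: "continuous_on UNIV (\<lambda>x. (T ^^ n) ((L ^^ n) x))"
proof -
  have iter: "bounded_linear (F ^^ n)" if "bounded_linear F" for F :: "'a \<Rightarrow> 'a"
    by (induction n) (auto simp: id_def comp_def intro: bounded_linear_ident bounded_linear_compose [OF that])
  show ?thesis
    by (intro linear_continuous_on bounded_linear_compose [OF iter iter]
        T.bounded_linear_axioms L.bounded_linear_axioms)
qed

text \<open>Membership in the range of \<open>T\<^sup>n\<close> becomes an equation between continuous functions, so these
  ranges, and with them the hyper-range, are closed.\<close>

lemma range_funpow_T: "range (T ^^ n) = {x. (T ^^ n) ((L ^^ n) x) = x}"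
proof (intro equalityI subsetI)
  fix x assume "x \<in> {x. (T ^^ n) ((L ^^ n) x) = x}"
  then have "x = (T ^^ n) ((L ^^ n) x)" by simp
  then show "x \<in> range (T ^^ n)" by (rule range_eqI)
qed auto

lemma closed_range_funpow_T: "closed (range (T ^^ n))"
  unfolding range_funpow_T
  by (intro closed_Collect_eq continuous_funpow_T_L continuous_on_id)

lemma hyper_rangeD: "x \<in> hyper_range T \<Longrightarrow> (T ^^ n) ((L ^^ n) x) = x"
  using range_funpow_T [of n] by (auto simp: hyper_range_def)

lemma csubspace_hyper_range: "csubspace (hyper_range T)"
proof -
  have iter: "(T ^^ n) 0 = 0" "(T ^^ n) (x + y) = (T ^^ n) x + (T ^^ n) y"
    "(T ^^ n) (c *\<^sub>C x) = c *\<^sub>C (T ^^ n) x" for n x y c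
    by (induction n) (simp_all add: T.zero T.add bounded_clinearD(2) [OF T])
  have "csubspace (range (T ^^ n))" for n
  proof (rule complex_vector.subspaceI)
    show "0 \<in> range (T ^^ n)"
      using iter(1) [of n] by (rule range_eqI [OF sym])
  next
    fix x y assume "x \<in> range (T ^^ n)" "y \<in> range (T ^^ n)"
    then obtain u v where "x = (T ^^ n) u" "y = (T ^^ n) v" by blast
    then show "x + y \<in> range (T ^^ n)"
      by (intro range_eqI [of _ _ "u + v"]) (simp add: iter)
  next
    fix c x assume "x \<in> range (T ^^ n)"
    then obtain u where "x = (T ^^ n) u" by blast
    then show "c *\<^sub>C x \<in> range (T ^^ n)"
      by (intro range_eqI [of _ _ "c *\<^sub>C u"]) (simp add: iter)
  qed
  then show ?thesis
    unfolding hyper_range_def by (intro complex_vector.subspace_Inter) auto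
qed

lemma closed_hyper_range: "closed (hyper_range T)"
  unfolding hyper_range_def using closed_range_funpow_T by blast

lemma T_hyper_range: "x \<in> hyper_range T \<Longrightarrow> T x \<in> hyper_range T"
proof -
  assume x: "x \<in> hyper_range T"
  have "T x \<in> range (T ^^ n)" for n
  proof (cases n)
    case (Suc k)
    have "T x = (T ^^ Suc k) ((L ^^ k) x)"
      using hyper_rangeD [OF x, of k] by simp
    then show ?thesis unfolding Suc by (rule range_eqI)
  qed simp
  then show ?thesis by (simp add: hyper_range_def)
qed

lemma L_hyper_range: "x \<in> hyper_range T \<Longrightarrow> L x \<in> hyper_range T"
proof -
  assume x: "x \<in> hyper_range T"
  have "L x \<in> range (T ^^ n)" for n
  proof -
    have "x = T ((T ^^ n) ((L ^^ Suc n) x))"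
      using hyper_rangeD [OF x, of "Suc n"] by simp
    then have "L x = (T ^^ n) ((L ^^ Suc n) x)"
      using L_T by metis
    then show ?thesis by (rule range_eqI)
  qed
  then show ?thesis by (simp add: hyper_range_def)
qed

lemma T_L_hyper_range: "x \<in> hyper_range T \<Longrightarrow> T (L x) = x"
  using hyper_rangeD [of x 1] by simp

end

section \<open>The quadratic forms of the operators \<open>\<beta>\<^sub>k(T)\<close>\<close>

text \<open>The value of the quadratic form of \<open>\<beta>\<^sub>r(T)\<close> at \<open>x\<close>. It is the \<open>r\<close>-th finite difference at \<open>0\<close>
  of \<open>n \<mapsto> \<parallel>T\<^sup>n x\<parallel>\<^sup>2\<close>; the recursion makes the binomial sums in
  \<open>\<beta>\<^sub>r(T)\<close> disappear from the argument.\<close>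

primrec beta_form :: "nat \<Rightarrow> ('a::complex_hilbert \<Rightarrow> 'a) \<Rightarrow> 'a \<Rightarrow> real" where
  "beta_form 0 T x = (norm x)\<^sup>2"
| "beta_form (Suc r) T x = beta_form r T (T x) - beta_form r T x"

text \<open>Pascal's rule. The alternating sum is the \<open>k\<close>-th difference of \<open>f\<close> at \<open>0\<close>.\<close>

lemma alternating_binomial_sum_Suc:
  fixes f :: "nat \<Rightarrow> real"
  shows "(\<Sum>j\<le>Suc k. real (Suc k choose j) * (- 1) ^ (Suc k - j) * f j)
    = (\<Sum>j\<le>k. real (k choose j) * (- 1) ^ (k - j) * f (Suc j))
      - (\<Sum>j\<le>k. real (k choose j) * (- 1) ^ (k - j) * f j)"
proof -
  have "(\<Sum>j\<le>k. real (k choose j) * (- 1) ^ (k - j) * f j)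
      = - (\<Sum>j\<le>k. real (k choose j) * (- 1) ^ (Suc k - j) * f j)"
    unfolding sum_negf [symmetric]
    by (intro sum.cong refl) (simp add: Suc_diff_le)
  also have "\<dots> = - (\<Sum>j\<le>Suc k. real (k choose j) * (- 1) ^ (Suc k - j) * f j)"
    by simp
  also have "\<dots> = (- 1) ^ k * f 0 - (\<Sum>j\<le>k. real (k choose Suc j) * (- 1) ^ (k - j) * f (Suc j))"
    by (subst sum.atMost_Suc_shift) simp
  finally show ?thesis
    by (subst sum.atMost_Suc_shift) (simp add: sum.distrib algebra_simps)
qed

lemma beta_form_eq_sum:
  "beta_form k T x = (\<Sum>j\<le>k. real (k choose j) * (- 1) ^ (k - j) * (norm ((T ^^ j) x))\<^sup>2)"
proof (induction k arbitrary: x)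
  case (Suc k)
  show ?case
    unfolding alternating_binomial_sum_Suc beta_form.simps Suc.IH
    by (simp add: funpow_swap1)
qed simp

lemma cinner_beta_op:
  assumes "bounded_clinear T"
  shows "cinner (beta_op k T x) x = complex_of_real (beta_form k T x)"
  by (simp add: beta_op_def cinner_sum_left cinner_scaleC_left cinner_cadjoint_funpow [OF assms]
      cinner_self beta_form_eq_sum)

text \<open>Concluding with the same bound \<open>- c\<close> lets the lemma be iterated, from a difference of high order
  of a sequence down to the sequence itself.\<close>

lemma eventually_negative_if_decrements:
  fixes f :: "nat \<Rightarrow> real"
  assumes "c > 0" "\<And>n. n \<ge> N \<Longrightarrow> f (Suc n) - f n \<le> - c"
  shows "\<exists>M. \<forall>n\<ge>M. f n \<le> - c"
proof -
  have le: "f (N + k) \<le> f N - real k * c" for k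
  proof (induction k)
    case (Suc k)
    then show ?case
      using assms(2) [of "N + k"] by (simp add: algebra_simps)
  qed simp
  obtain k0 where k0: "f N + c < real k0 * c"
    using reals_Archimedean3 [OF \<open>c > 0\<close>] by blast
  have "f n \<le> - c" if "n \<ge> N + k0" for n
  proof -
    from that obtain k where n: "n = N + k" and "k \<ge> k0"
      by (metis add_le_cancel_left le_Suc_ex le_add1 le_trans)
    then have "real k0 * c \<le> real k * c"
      using \<open>c > 0\<close> by simp
    then show ?thesis
      using le [of k] k0 n by simp
  qed
  then show ?thesis by blast
qed

text \<open>Exchange of the two summations. The weight \<open>p choose Suc q\<close> collects the weights \<open>n choose q\<close> of
  all \<open>n < p\<close>.\<close>

lemma sum_binomial_tails:
  fixes g :: "nat \<Rightarrow> real"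
  shows "(\<Sum>p<N. real (p choose Suc q) * g p)
    = (\<Sum>n<N. real (n choose q) * (\<Sum>p\<in>{Suc n..<N}. g p))"
proof (induction N)
  case (Suc N)
  have hockey: "(\<Sum>n<N. real (n choose q)) = real (N choose Suc q)"
    by (induction N) auto
  have "(\<Sum>n<Suc N. real (n choose q) * (\<Sum>p\<in>{Suc n..<Suc N}. g p))
      = (\<Sum>n<N. real (n choose q) * ((\<Sum>p\<in>{Suc n..<N}. g p) + g N))"
    by (auto intro!: sum.cong)
  also have "\<dots> = (\<Sum>p<Suc N. real (p choose Suc q) * g p)"
    by (simp add: Suc.IH distrib_left sum.distrib hockey flip: sum_distrib_right)
  finally show ?case by simp
qed simp

section \<open>Positivity and weighted summability\<close>

text \<open>The conditions on \<open>\<beta>\<^sub>r(T)\<close>, written for the quadratic forms: \<open>m\<close>-concavity, and the domination of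
  \<open>\<Sum>\<^sub>k L\<^sup>*\<^sup>k \<beta>\<^sub>r\<^sub>+\<^sub>1(T) L\<^sup>k\<close> by \<open>\<beta>\<^sub>r(T)\<close>.\<close>

locale beta_dominating_operator = left_invertible_operator T
  for T :: "'a::complex_hilbert \<Rightarrow> 'a" +
  fixes m :: nat
  assumes m_ge_2: "m \<ge> 2"
    and concave: "beta_form m T x \<le> 0"
    and summable_beta: "r \<in> {1..m - 2} \<Longrightarrow> summable (\<lambda>k. beta_form (Suc r) T ((L ^^ Suc k) x))"
    and suminf_beta: "r \<in> {1..m - 2} \<Longrightarrow>
      (\<Sum>k. beta_form (Suc r) T ((L ^^ Suc k) x)) \<le> beta_form r T x"
begin

abbreviation b :: "nat \<Rightarrow> 'a \<Rightarrow> real" where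
  "b r \<equiv> beta_form r T"

text \<open>By \<open>m\<close>-concavity \<open>b (m - 1)\<close> decreases along the orbit of \<open>x\<close>. If it were negative at \<open>x\<close>, it
  would stay below a negative constant; summing \<open>m - 1\<close> times, \<open>\<parallel>T\<^sup>n x\<parallel>\<^sup>2 = b 0 (T\<^sup>n x)\<close> would
  become negative.\<close>

lemma top_beta_nonneg: "0 \<le> b (m - 1) x"
proof (rule ccontr)
  assume "\<not> 0 \<le> b (m - 1) x"
  define c where "c = - b (m - 1) x"
  have "c > 0"
    using \<open>\<not> 0 \<le> b (m - 1) x\<close> by (simp add: c_def)
  obtain k where m: "m = Suc k"
    using m_ge_2 by (cases m) auto
  have top: "b (m - 1) ((T ^^ n) x) \<le> - c" for n
  proof (induction n)
    case (Suc n)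
    then show ?case
      using concave [of "(T ^^ n) x"] by (simp add: m)
  qed (simp add: c_def)
  have "\<exists>N. \<forall>n\<ge>N. b 0 ((T ^^ n) x) \<le> - c"
  proof (rule inc_induct [of 0 "m - 1"])
    fix r assume "\<exists>N. \<forall>n\<ge>N. b (Suc r) ((T ^^ n) x) \<le> - c"
    then obtain N where "\<And>n. n \<ge> N \<Longrightarrow> b r ((T ^^ Suc n) x) - b r ((T ^^ n) x) \<le> - c"
      by auto
    then show "\<exists>N. \<forall>n\<ge>N. b r ((T ^^ n) x) \<le> - c"
      by (rule eventually_negative_if_decrements [where f = "\<lambda>n. b r ((T ^^ n) x)", OF \<open>c > 0\<close>])
  qed (use top in auto)
  then obtain n where "(norm ((T ^^ n) x))\<^sup>2 \<le> - c" by auto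
  with \<open>c > 0\<close> show False
    by (smt (verit) zero_le_power2)
qed

text \<open>Each \<open>b r\<close> dominates a series of values of \<open>b (Suc r)\<close>, so positivity descends from the top.\<close>

lemma beta_nonneg:
  assumes "1 \<le> r" "r \<le> m - 1"
  shows "0 \<le> b r x"
  using assms(2)
proof (induction arbitrary: x rule: inc_induct)
  case base
  show ?case by (rule top_beta_nonneg)
next
  case (step r')
  then have "r' \<in> {1..m - 2}" using assms(1) by auto
  moreover have "0 \<le> (\<Sum>k. b (Suc r') ((L ^^ Suc k) x))"
    using step.IH by (intro suminf_nonneg summable_beta [OF \<open>r' \<in> _\<close>])
  ultimately show ?case
    using suminf_beta [of r' x] by linarith
qed

lemma sum_beta_le:
  assumes "r \<in> {1..m - 2}"
  shows "(\<Sum>k<N. b (Suc r) ((L ^^ Suc k) x)) \<le> b r x"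
proof -
  have "(\<Sum>k<N. b (Suc r) ((L ^^ Suc k) x)) \<le> (\<Sum>k. b (Suc r) ((L ^^ Suc k) x))"
    using assms by (intro sum_le_suminf summable_beta beta_nonneg) auto
  with suminf_beta [OF assms] show ?thesis by (rule order_trans [rotated])
qed

text \<open>Split \<open>L\<^sup>n x\<close> orthogonally along the range of \<open>T\<close>. The component in the range is
  \<open>T (L\<^sup>n\<^sup>+\<^sup>1 x)\<close>, whose squared norm exceeds \<open>\<parallel>L\<^sup>n\<^sup>+\<^sup>1 x\<parallel>\<^sup>2\<close> by \<open>b 1 (L\<^sup>n\<^sup>+\<^sup>1 x)\<close>. This is
  the domination condition for \<open>r = 0\<close>.\<close>

lemma energy_le: "(\<Sum>k<n. b 1 ((L ^^ Suc k) x)) + (norm ((L ^^ n) x))\<^sup>2 \<le> (norm x)\<^sup>2"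
proof (induction n)
  case (Suc n)
  have "b 1 ((L ^^ Suc n) x) + (norm ((L ^^ Suc n) x))\<^sup>2 \<le> (norm ((L ^^ n) x))\<^sup>2"
    using Pythagoras_residual [of "(L ^^ n) x"] by simp
  with Suc show ?case
    unfolding sum.lessThan_Suc by linarith
qed simp

text \<open>On the hyper-range no energy is lost: every residual vanishes.\<close>

lemma energy_eq:
  assumes "x \<in> hyper_range T"
  shows "(\<Sum>k<n. b 1 ((L ^^ Suc k) x)) + (norm ((L ^^ n) x))\<^sup>2 = (norm x)\<^sup>2"
proof -
  have mem: "(L ^^ k) x \<in> hyper_range T" for k
    by (induction k) (simp_all add: assms L_hyper_range)
  show ?thesis
  proof (induction n)
    case (Suc n)
    have "b 1 ((L ^^ Suc n) x) + (norm ((L ^^ Suc n) x))\<^sup>2 = (norm ((L ^^ n) x))\<^sup>2"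
      using T_L_hyper_range [OF mem [of n]] by simp
    with Suc show ?case by simp
  qed simp
qed

text \<open>Iterating the domination conditions from the energy inequality upwards gives \<open>(q + 1)\<close>-fold sums of
  \<open>b (Suc q)\<close> along \<open>L\<^sup>n x\<close>; the index \<open>n + 1\<close> is the sum of \<open>q + 1\<close> positive indices
  in \<open>n choose q\<close> ways.\<close>

lemma weighted_beta_sum_le:
  assumes "q < m - 1"
  shows "(\<Sum>n<N. real (n choose q) * b (Suc q) ((L ^^ Suc n) x)) \<le> (norm x)\<^sup>2"
  using assms
proof (induction q)
  case 0
  show ?case
    by (simp add: order_trans [OF _ energy_le [of x N]])
next
  case (Suc q)
  have tail: "(\<Sum>p\<in>{Suc n..<N}. b (Suc (Suc q)) ((L ^^ Suc p) x)) \<le> b (Suc q) ((L ^^ Suc n) x)" for n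
  proof -
    have "(L ^^ Suc (Suc n + k)) x = (L ^^ Suc k) ((L ^^ Suc n) x)" for k
      by (metis add.commute add_Suc comp_apply funpow_add)
    then have "(\<Sum>p\<in>{Suc n..<N}. b (Suc (Suc q)) ((L ^^ Suc p) x))
        = (\<Sum>k<N - Suc n. b (Suc (Suc q)) ((L ^^ Suc k) ((L ^^ Suc n) x)))"
      by (subst sum.atLeastLessThan_shift_0) (simp add: atLeast0LessThan del: funpow.simps beta_form.simps)
    then show ?thesis
      using sum_beta_le [of "Suc q"] Suc.prems by simp
  qed
  have "(\<Sum>p<N. real (p choose Suc q) * b (Suc (Suc q)) ((L ^^ Suc p) x))
      = (\<Sum>n<N. real (n choose q) * (\<Sum>p\<in>{Suc n..<N}. b (Suc (Suc q)) ((L ^^ Suc p) x)))"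
    by (rule sum_binomial_tails)
  also have "\<dots> \<le> (\<Sum>n<N. real (n choose q) * b (Suc q) ((L ^^ Suc n) x))"
    by (intro sum_mono mult_left_mono tail) simp
  also have "\<dots> \<le> (norm x)\<^sup>2"
    using Suc by simp
  finally show ?case .
qed

section \<open>Growth of \<open>T\<^sup>n L\<^sup>n x\<close>\<close>

text \<open>Newton's forward difference formula for \<open>n \<mapsto> \<parallel>T\<^sup>n y\<parallel>\<^sup>2\<close>, cut off at order \<open>m\<close>. The error
  has the right sign because the \<open>m\<close>-th differences are nonpositive.\<close>

lemma norm_funpow_T_le: "(norm ((T ^^ n) y))\<^sup>2 \<le> (\<Sum>i<m. real (n choose i) * b i y)"
proof -
  obtain k where m: "m = Suc k"
    using m_ge_2 by (cases m) auto
  show ?thesis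
  proof (induction n arbitrary: y)
    case 0
    show ?case
      unfolding m by (subst sum.lessThan_Suc_shift) simp
  next
    case (Suc n)
    have "(norm ((T ^^ Suc n) y))\<^sup>2 \<le> (\<Sum>i<m. real (n choose i) * b i (T y))"
      using Suc [of "T y"] by (simp add: funpow_swap1)
    also have "\<dots> = (\<Sum>i<m. real (n choose i) * b i y) + (\<Sum>i<m. real (n choose i) * b (Suc i) y)"
      by (simp add: algebra_simps flip: sum.distrib)
    \<comment> \<open>The dropped term is the one with \<open>b m\<close>.\<close>
    also have "(\<Sum>i<m. real (n choose i) * b (Suc i) y) \<le> (\<Sum>i<k. real (n choose i) * b (Suc i) y)"
      using concave [of y] by (simp add: m mult_nonneg_nonpos del: beta_form.simps)
    also have "(\<Sum>i<m. real (n choose i) * b i y) + (\<Sum>i<k. real (n choose i) * b (Suc i) y)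
        = (\<Sum>i<m. real (Suc n choose i) * b i y)"
      unfolding m by (subst (1 2) sum.lessThan_Suc_shift)
        (simp add: distrib_right sum.distrib del: beta_form.simps)
    finally show ?case by simp
  qed
qed

text \<open>Up to the factor \<open>n + 1\<close>, this bounds how far \<open>\<parallel>T\<^sup>n\<^sup>+\<^sup>1 L\<^sup>n\<^sup>+\<^sup>1 x\<parallel>\<^sup>2\<close> exceeds
  \<open>\<parallel>L\<^sup>n\<^sup>+\<^sup>1 x\<parallel>\<^sup>2\<close>.\<close>

definition excess :: "'a \<Rightarrow> nat \<Rightarrow> real" where
  "excess x n = (\<Sum>q<m - 1. real (n choose q) * b (Suc q) ((L ^^ Suc n) x))"

lemma excess_nonneg: "0 \<le> excess x n"
  unfolding excess_def by (intro sum_nonneg mult_nonneg_nonneg beta_nonneg) auto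

lemma summable_excess: "summable (excess x)"
proof (rule bounded_imp_summable)
  show "(\<Sum>n\<le>N. excess x n) \<le> real (m - 1) * (norm x)\<^sup>2" for N
  proof -
    have "(\<Sum>n\<le>N. excess x n)
        = (\<Sum>q<m - 1. \<Sum>n<Suc N. real (n choose q) * b (Suc q) ((L ^^ Suc n) x))"
      unfolding excess_def lessThan_Suc_atMost by (rule sum.swap)
    also have "\<dots> \<le> (\<Sum>q<m - 1. (norm x)\<^sup>2)"
      by (intro sum_mono weighted_beta_sum_le) auto
    finally show ?thesis by simp
  qed
qed (rule excess_nonneg)

text \<open>The truncated Newton formula at \<open>y = L\<^sup>n\<^sup>+\<^sup>1 x\<close>, with the coefficients compared through
  \<open>(n + 1) * (n choose q) = (q + 1) * (n + 1 choose q + 1)\<close>.\<close>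

lemma norm_T_L_le:
  "(norm ((T ^^ Suc n) ((L ^^ Suc n) x)))\<^sup>2 \<le> (norm ((L ^^ Suc n) x))\<^sup>2 + real (Suc n) * excess x n"
proof -
  obtain k where m: "m = Suc k"
    using m_ge_2 by (cases m) auto
  let ?y = "(L ^^ Suc n) x"
  have "(norm ((T ^^ Suc n) ?y))\<^sup>2 \<le> (\<Sum>i<m. real (Suc n choose i) * b i ?y)"
    by (rule norm_funpow_T_le)
  also have "\<dots> = (norm ?y)\<^sup>2 + (\<Sum>q<k. real (Suc n choose Suc q) * b (Suc q) ?y)"
    unfolding m by (subst sum.lessThan_Suc_shift) (simp del: binomial_Suc_Suc beta_form.simps(2) funpow.simps)
  also have "(\<Sum>q<k. real (Suc n choose Suc q) * b (Suc q) ?y)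
      \<le> (\<Sum>q<k. real (Suc n * (n choose q)) * b (Suc q) ?y)"
  proof (intro sum_mono mult_right_mono beta_nonneg)
    fix q
    show "real (Suc n choose Suc q) \<le> real (Suc n * (n choose q))"
      unfolding Suc_times_binomial_eq by simp
  qed (auto simp: m)
  also have "\<dots> = real (Suc n) * excess x n"
    unfolding excess_def
    by (simp only: m diff_Suc_1 of_nat_mult sum_distrib_left mult.assoc)
  finally show ?thesis by simp
qed

text \<open>If \<open>(n + 1) * excess x n\<close> stayed above \<open>e > 0\<close>, the summable sequence \<open>excess x\<close> would dominate a
  multiple of the harmonic series.\<close>

lemma norm_T_L_less_frequently:
  assumes "e > 0"
  shows "\<exists>n>K. (norm ((T ^^ n) ((L ^^ n) x)))\<^sup>2 < (norm ((L ^^ n) x))\<^sup>2 + e"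
proof -
  have "\<exists>n\<ge>K. real (Suc n) * excess x n < e"
  proof (rule ccontr)
    assume "\<not> ?thesis"
    then have "norm (e * inverse (real (Suc n))) \<le> excess x n" if "n \<ge> K" for n
      using that \<open>e > 0\<close> by (auto simp: not_less field_simps)
    then have "summable (\<lambda>n. e * inverse (real (Suc n)))"
      by (rule summable_comparison_test' [OF summable_excess])
    then have "summable (\<lambda>n. inverse (real (Suc n)))"
      using \<open>e > 0\<close> by (simp only: summable_cmult_iff) simp
    then have "summable (\<lambda>n. inverse (real n))"
      by (simp only: summable_Suc_iff [of "\<lambda>n. inverse (real n)"])
    then show False
      using not_summable_harmonic [where 'a = real] by simp
  qed
  then obtain n where "n \<ge> K" "real (Suc n) * excess x n < e" by blast
  then show ?thesis
    using norm_T_L_le [of n x] by (intro exI [of _ "Suc n"]) linarith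
qed

section \<open>The Wold-type decomposition\<close>

text \<open>For \<open>y\<close> in the hyper-range, \<open>\<parallel>T\<^sup>n L\<^sup>n y\<parallel>\<^sup>2 - \<parallel>L\<^sup>n y\<parallel>\<^sup>2 = \<parallel>y\<parallel>\<^sup>2 - \<parallel>L\<^sup>n y\<parallel>\<^sup>2\<close> is the sum of the
  nonnegative numbers \<open>b 1 (L\<^sup>k y)\<close> for \<open>k = 1, \<dots>, n\<close>. It is arbitrarily small for suitable \<open>n\<close>, so
  the first summand, which is \<open>b 1 x\<close> for \<open>y = T x\<close>, is zero.\<close>

lemma beta_one_hyper_range:
  assumes "x \<in> hyper_range T"
  shows "b 1 x = 0"
proof -
  let ?y = "T x"
  have y: "?y \<in> hyper_range T"
    using assms by (rule T_hyper_range)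
  have nonneg: "0 \<le> b 1 z" for z
    using m_ge_2 by (intro beta_nonneg) auto
  have "b 1 x < e" if "e > 0" for e
  proof -
    obtain n where "n > 0"
      and n: "(norm ((T ^^ n) ((L ^^ n) ?y)))\<^sup>2 < (norm ((L ^^ n) ?y))\<^sup>2 + e"
      using norm_T_L_less_frequently [OF \<open>e > 0\<close>] by blast
    have "b 1 ((L ^^ Suc 0) ?y) \<le> (\<Sum>k<n. b 1 ((L ^^ Suc k) ?y))"
      using \<open>n > 0\<close> by (intro member_le_sum [of 0 _ "\<lambda>k. b 1 ((L ^^ Suc k) ?y)"] nonneg) auto
    also have "\<dots> < e"
      using energy_eq [OF y, of n] n unfolding hyper_rangeD [OF y] by linarith
    finally show ?thesis by simp
  qed
  with nonneg [of x] show ?thesis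
    by (metis less_irrefl order_le_less)
qed

text \<open>\<open>b 1\<close> is the form of \<open>T\<^sup>*T - I \<ge> 0\<close>, and a vector at which a positive form vanishes is
  annihilated by its operator.\<close>

lemma cadjoint_T_T_hyper_range:
  assumes "x \<in> hyper_range T"
  shows "cadjoint T (T x) = x"
proof -
  define d where "d = cadjoint T (T x) - x"
  have d: "inner (T x) (T d) = inner x d + inner d d"
    by (simp add: d_def inner_eq_Re_cinner cinner_cadjoint_left [OF T, symmetric] cinner_diff_left)
  have "inner d d = 0"
  proof (rule quadratic_nonneg_imp_linear_part_zero)
    fix t
    have "0 \<le> b 1 (x + t *\<^sub>R d)"
      using m_ge_2 by (intro beta_nonneg) auto
    also have "\<dots> = b 1 x + 2 * t * (inner (T x) (T d) - inner x d) + t\<^sup>2 * b 1 d"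
      by (simp add: T.add T.scaleR power2_norm_eq_inner inner_add_left inner_add_right
          inner_commute power2_eq_square [of t] algebra_simps)
    finally show "0 \<le> 2 * t * inner d d + t\<^sup>2 * b 1 d"
      unfolding beta_one_hyper_range [OF assms] d by simp
  qed
  then show ?thesis by (simp add: d_def)
qed

text \<open>The adjoint is the inverse on the hyper-range, so the hyper-range is invariant under both \<open>T\<close> and
  \<open>T\<^sup>*\<close>. That it reduces \<open>T\<close> to a unitary operator follows.\<close>

lemma cadjoint_T_hyper_range:
  assumes "x \<in> hyper_range T"
  shows "cadjoint T x = L x"
  using cadjoint_T_T_hyper_range [OF L_hyper_range [OF assms]] T_L_hyper_range [OF assms] by simp

lemma reducing_hyper_range: "reducing T (hyper_range T)"
  unfolding reducing_def
proof (intro conjI image_subsetI)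
  show "T x \<in> cortho_comp (hyper_range T)" if "x \<in> cortho_comp (hyper_range T)" for x
    using that cadjoint_T_hyper_range L_hyper_range
    by (auto simp: cortho_comp_def cinner_cadjoint [OF T])
qed (auto intro: csubspace_hyper_range closed_hyper_range T_hyper_range)

lemma unitary_on_hyper_range: "unitary_on (hyper_range T) T"
proof -
  have adj: "cadjoint_on (hyper_range T) T x = L x" if "x \<in> hyper_range T" for x
    using that
    by (intro cadjoint_on_eqI csubspace_hyper_range L_hyper_range)
      (simp_all add: cinner_cadjoint [OF T] cadjoint_T_hyper_range)
  show ?thesis
    by (auto simp: unitary_on_def T_hyper_range adj T_L_hyper_range)
qed

lemma cadjoint_on_cortho_comp_hyper_range:
  assumes "x \<in> cortho_comp (hyper_range T)"
  shows "cadjoint_on (cortho_comp (hyper_range T)) T x = cadjoint T x"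
proof (rule cadjoint_on_eqI [OF csubspace_cortho_comp])
  show "cadjoint T x \<in> cortho_comp (hyper_range T)"
    using assms T_hyper_range by (auto simp: cortho_comp_def cinner_cadjoint_left [OF T])
qed (rule cinner_cadjoint [OF T])

lemma kernel_cadjoint_subset:
  assumes "cadjoint T e = 0"
  shows "e \<in> cortho_comp (hyper_range T)"
proof -
  have "cinner e y = 0" if "y \<in> hyper_range T" for y
    using cinner_cadjoint_left [OF T, of e "L y"] assms T_L_hyper_range [OF that] by simp
  then show ?thesis
    by (simp add: cortho_comp_def)
qed

text \<open>\<open>x - T\<^sup>n L\<^sup>n x\<close> is the sum of the wandering vectors \<open>T\<^sup>k (L\<^sup>k x - T L\<^sup>k\<^sup>+\<^sup>1 x)\<close> with \<open>k < n\<close>, so \<open>x\<close> is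
  orthogonal to it and \<open>\<parallel>T\<^sup>n L\<^sup>n x - x\<parallel>\<^sup>2 = \<parallel>T\<^sup>n L\<^sup>n x\<parallel>\<^sup>2 - \<parallel>x\<parallel>\<^sup>2\<close>. The norm estimate makes this
  arbitrarily small for large suitable \<open>n\<close>: the vector \<open>x\<close> is a limit of vectors in the closed
  range of every power of \<open>T\<close>.\<close>

lemma orthogonal_to_wandering_imp_in_hyper_range:
  assumes "\<And>n e. cadjoint T e = 0 \<Longrightarrow> inner x ((T ^^ n) e) = 0"
  shows "x \<in> hyper_range T"
proof -
  define R where "R n = (T ^^ n) ((L ^^ n) x)" for n
  have inner_R: "inner x (R n) = (norm x)\<^sup>2" for n
  proof (induction n)
    case 0
    show ?case by (simp add: R_def power2_norm_eq_inner)
  next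
    case (Suc n)
    let ?e = "(L ^^ n) x - T (L ((L ^^ n) x))"
    have "cadjoint T ?e = 0"
      by (rule cinner_eqI) (simp add: cinner_cadjoint [OF T, symmetric],
          metis cinner_commute cinner_residual_range complex_cnj_zero)
    then have "inner x ((T ^^ n) ?e) = 0" by (rule assms)
    moreover have "(T ^^ n) ?e = R n - R (Suc n)"
    proof -
      have "(T ^^ n) (u - v) = (T ^^ n) u - (T ^^ n) v" for u v
        by (induction n) (simp_all add: T.diff)
      then show ?thesis by (simp add: R_def funpow_swap1)
    qed
    ultimately show ?case
      using Suc by (simp add: inner_diff_right)
  qed
  have close: "\<exists>n>K. (norm (R n - x))\<^sup>2 < e" if "e > 0" for K e
  proof -
    obtain n where "n > K" and n: "(norm (R n))\<^sup>2 < (norm ((L ^^ n) x))\<^sup>2 + e"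
      using norm_T_L_less_frequently [OF \<open>e > 0\<close>] unfolding R_def by blast
    have "0 \<le> (\<Sum>k<n. b 1 ((L ^^ Suc k) x))"
      using m_ge_2 by (intro sum_nonneg beta_nonneg) auto
    then have "(norm (R n))\<^sup>2 < (norm x)\<^sup>2 + e"
      using n energy_le [of x n] by linarith
    moreover have "(norm (R n - x))\<^sup>2 = (norm (R n))\<^sup>2 - (norm x)\<^sup>2"
      using inner_R [of n]
      by (simp add: power2_norm_eq_inner inner_diff_left inner_diff_right inner_commute)
    ultimately show ?thesis using \<open>n > K\<close> by auto
  qed
  have "x \<in> range (T ^^ K)" for K
  proof -
    have "\<exists>y\<in>range (T ^^ K). dist y x < e" if "e > 0" for e
    proof -
      obtain n where "n > K" "(norm (R n - x))\<^sup>2 < e\<^sup>2"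
        using close [of "e\<^sup>2" K] \<open>e > 0\<close> by auto
      moreover have "R n = (T ^^ K) ((T ^^ (n - K)) ((L ^^ n) x))"
        using \<open>n > K\<close> fun_cong [OF funpow_add [of K "n - K" T]] by (simp add: R_def)
      ultimately show ?thesis
        using \<open>e > 0\<close> power_less_imp_less_base [of "norm (R n - x)" 2 e]
        by (intro bexI [of _ "R n"]) (auto simp: dist_norm)
    qed
    then have "x \<in> closure (range (T ^^ K))"
      by (simp only: closure_approachable) blast
    then show ?thesis
      by (simp only: closure_closed [OF closed_range_funpow_T])
  qed
  then show ?thesis by (simp add: hyper_range_def)
qed

text \<open>Project \<open>x \<in> cortho_comp (hyper_range T)\<close> onto the closed span of the wandering vectors. The difference is
  orthogonal to these vectors, hence in the hyper-range; it is also orthogonal to the hyper-range, hence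
  zero.\<close>

lemma wandering_subspace_property:
  "wandering_subspace_property_on (cortho_comp (hyper_range T)) T"
proof -
  let ?K = "cortho_comp (hyper_range T)"
  define W where "W = {(T ^^ n) x | n x. x \<in> ?K \<and> cadjoint_on ?K T x = 0}"
  have W: "(T ^^ n) e \<in> W" if "cadjoint T e = 0" for n e
  proof -
    have e: "e \<in> ?K"
      using that by (rule kernel_cadjoint_subset)
    have "cadjoint_on ?K T e = 0"
      by (rule trans [OF cadjoint_on_cortho_comp_hyper_range [OF e] that])
    with e show ?thesis
      unfolding W_def by blast
  qed
  have "W \<subseteq> ?K"
  proof -
    have "(T ^^ n) x \<in> ?K" if "x \<in> ?K" for n x
      using reducing_hyper_range that by (induction n) (auto simp: reducing_def)
    then show ?thesis by (auto simp: W_def)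
  qed
  then have sub: "closure (cspan W) \<subseteq> ?K"
    by (intro closure_minimal complex_vector.span_minimal csubspace_cortho_comp closed_cortho_comp)
  have "?K \<subseteq> closure (cspan W)"
  proof
    fix x assume "x \<in> ?K"
    have "subspace (cspan W)"
      by (rule csubspace_imp_subspace [OF complex_vector.subspace_span])
    then obtain y where y: "y \<in> closure (cspan W)" "\<And>s. s \<in> cspan W \<Longrightarrow> inner (x - y) s = 0"
      by (rule orthogonal_projection_exists) blast
    have "x - y \<in> hyper_range T"
      using y(2) W by (intro orthogonal_to_wandering_imp_in_hyper_range) (auto intro: complex_vector.span_base)
    moreover have "x - y \<in> ?K"
      using \<open>x \<in> ?K\<close> y(1) sub
      by (auto intro: complex_vector.subspace_diff [OF csubspace_cortho_comp])
    ultimately have "cinner (x - y) (x - y) = 0"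
      by (rule cortho_compD [rotated])
    then show "x \<in> closure (cspan W)"
      using y(1) by (simp add: cinner_self)
  qed
  with sub show ?thesis
    unfolding wandering_subspace_property_on_def W_def by blast
qed

end

theorem theorem5p7:
  fixes T :: "'a::complex_hilbert \<Rightarrow> 'a" and m :: nat
  assumes "separable_space (euclidean :: 'a topology)"
    and "bounded_clinear T"
    and "left_invertible T"
    and "m \<ge> 2"
    and "m_concave m T"
    and "\<forall>r\<in>{1..m - 2}. op_series_le
           (\<lambda>k. (cadjoint (left_inv_op T) ^^ k) \<circ> beta_op (r + 1) T \<circ> (left_inv_op T ^^ k))
           (beta_op r T)"
  shows "admits_Wold_type_decomposition T"
proof -
  interpret left_invertible_operator T
    using assms(2,3) by unfold_locales
  have series: "summable (\<lambda>k. beta_form (Suc r) T ((L ^^ Suc k) x))"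
      "(\<Sum>k. beta_form (Suc r) T ((L ^^ Suc k) x)) \<le> beta_form r T x"
    if "r \<in> {1..m - 2}" for r x
  proof -
    have form: "cinner (((cadjoint L ^^ k) \<circ> beta_op (r + 1) T \<circ> (L ^^ k)) y) y
        = complex_of_real (beta_form (Suc r) T ((L ^^ k) y))" for k y
      by (simp add: cinner_cadjoint_funpow [OF bounded_clinear_L] cinner_beta_op [OF assms(2)]
          del: beta_form.simps)
    have *: "summable (\<lambda>k. complex_of_real (beta_form (Suc r) T ((L ^^ Suc k) x)))"
      "(\<Sum>k. complex_of_real (beta_form (Suc r) T ((L ^^ Suc k) x))) \<le> complex_of_real (beta_form r T x)"
      using bspec [OF assms(6) that] unfolding op_series_le_def form cinner_beta_op [OF assms(2)]
      by blast+
    show summable: "summable (\<lambda>k. beta_form (Suc r) T ((L ^^ Suc k) x))"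
      using *(1) by (simp only: summable_complex_of_real)
    show "(\<Sum>k. beta_form (Suc r) T ((L ^^ Suc k) x)) \<le> beta_form r T x"
      using *(2) unfolding suminf_of_real [OF summable, symmetric] by (simp add: less_eq_complex_def)
  qed
  interpret beta_dominating_operator T m
  proof unfold_locales
    show "beta_form m T x \<le> 0" for x
      using assms(5) by (simp add: m_concave_def op_le_def cinner_beta_op [OF assms(2)] less_eq_complex_def)
  qed (use assms(4) series in auto)
  show ?thesis
    unfolding admits_Wold_type_decomposition_def
    using reducing_hyper_range unitary_on_hyper_range wandering_subspace_property by blast
qed

end
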